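(* Let $G$ be a $2$-connected graph of order $n\geq 3$ such that $d(x)+d(y)\geq n-1$ for every pair of non-adjacent vertices $x$ and $y$ of $G$. (i) If $n$ is even, then $G$ is hamiltonian. (ii) If $n$ is odd, then $G$ contains a cycle of length at least $n-1$. Moreover, $G$ is not hamiltonian only if the minimal degree of its $n$-closure $Cl_n(G)$ equals $(n-1)/2$; and in this case $Cl_n(G)$ is a maximal non-hamiltonian graph.
   Context: All graphs are finite, undirected, without loops or multiple edges; $d(x)$ denotes the degree of a vertex $x$. The $n$-closure $Cl_n(G)$ of a graph $G$ on $n$ vertices is the graph obtained from $G$ by successively joining pairs $x,y$ of non-adjacent vertices satisfying $d(x)+d(y)\geq n$ (degrees taken in the current graph) until no such pair remains. A graph is maximal non-hamiltonian if it is not hamiltonian but adding any edge between two of its non-adjacent vertices yields a hamiltonian graph. *)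

theory Defs
  imports Complex_Main "Graph_Theory.Graph_Theory"
begin

text \<open>
  A finite simple undirected graph is a \<^locale>\<open>pair_graph\<close>: a finite loop-free symmetric digraph
  without parallel arcs. The edge between \<open>x\<close> and \<open>y\<close> is the pair of arcs \<open>(x, y)\<close> and \<open>(y, x)\<close>,
  so the degree of a vertex is its out-degree.
\<close>

definition degree :: "'a pair_pre_digraph \<Rightarrow> 'a \<Rightarrow> nat" where
  "degree G x = out_degree (with_proj G) x"

definition min_degree :: "'a pair_pre_digraph \<Rightarrow> nat" where
  "min_degree G = Min (degree G ` pverts G)"

definition nonadjacent :: "'a pair_pre_digraph \<Rightarrow> 'a \<Rightarrow> 'a \<Rightarrow> bool" where
  "nonadjacent G x y \<longleftrightarrow>
     x \<in> pverts G \<and> y \<in> pverts G \<and> x \<noteq> y \<and> (x, y) \<notin> parcs G"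

definition add_edge :: "'a pair_pre_digraph \<Rightarrow> 'a \<Rightarrow> 'a \<Rightarrow> 'a pair_pre_digraph" where
  "add_edge G x y = G\<lparr>parcs := parcs G \<union> {(x, y), (y, x)}\<rparr>"

definition k_connected :: "nat \<Rightarrow> 'a pair_pre_digraph \<Rightarrow> bool" where
  "k_connected k G \<longleftrightarrow>
     k < card (pverts G) \<and>
     (\<forall>S \<subseteq> pverts G. card S < k \<longrightarrow> connected (with_proj G \<restriction> (pverts G - S)))"

text \<open>
  The library notion of cycle, being one for digraphs, also admits the closed walk \<open>x, y, x\<close> along
  a single undirected edge; the length bound excludes it.
\<close>

definition graph_cycle :: "'a pair_pre_digraph \<Rightarrow> ('a \<times> 'a) list \<Rightarrow> bool" where
  "graph_cycle G p \<longleftrightarrow> pre_digraph.cycle (with_proj G) p \<and> 3 \<le> length p"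

definition hamiltonian :: "'a pair_pre_digraph \<Rightarrow> bool" where
  "hamiltonian G \<longleftrightarrow> (\<exists>p. graph_cycle G p \<and> fst ` set p = pverts G)"

definition maximal_nonhamiltonian :: "'a pair_pre_digraph \<Rightarrow> bool" where
  "maximal_nonhamiltonian G \<longleftrightarrow>
     \<not> hamiltonian G \<and> (\<forall>x y. nonadjacent G x y \<longrightarrow> hamiltonian (add_edge G x y))"

definition closure_step :: "nat \<Rightarrow> 'a pair_pre_digraph \<Rightarrow> 'a pair_pre_digraph \<Rightarrow> bool" where
  "closure_step k G H \<longleftrightarrow>
     (\<exists>x y. nonadjacent G x y \<and> k \<le> degree G x + degree G y \<and> H = add_edge G x y)"

definition is_closure :: "nat \<Rightarrow> 'a pair_pre_digraph \<Rightarrow> 'a pair_pre_digraph \<Rightarrow> bool" where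
  "is_closure k G H \<longleftrightarrow> (closure_step k)\<^sup>*\<^sup>* G H \<and> \<not> (\<exists>H'. closure_step k H H')"

text \<open>The closure is well defined by \<open>ex1_is_closure\<close> below.\<close>

definition Cl :: "nat \<Rightarrow> 'a pair_pre_digraph \<Rightarrow> 'a pair_pre_digraph" where
  "Cl k G = (THE H. is_closure k G H)"

lemma pair_graph_add_edge:
  assumes "pair_graph G" "nonadjacent G x y"
  shows "pair_graph (add_edge G x y)"
proof -
  interpret pair_graph G by fact
  have xy: "x \<in> pverts G" "y \<in> pverts G" "x \<noteq> y"
    using assms(2) by (simp_all add: nonadjacent_def)
  have arcs: "parcs (add_edge G x y) = insert (x, y) (insert (y, x) (parcs G))"
    and verts: "pverts (add_edge G x y) = pverts G"
    by (auto simp: add_edge_def)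
  show ?thesis
  proof
    fix e assume "e \<in> parcs (add_edge G x y)"
    then have e: "e = (x, y) \<or> e = (y, x) \<or> e \<in> parcs G"
      unfolding arcs by blast
    show "fst e \<in> pverts (add_edge G x y)" "snd e \<in> pverts (add_edge G x y)"
      unfolding verts using e xy arc_fst_in_verts[of e] arc_snd_in_verts[of e] by auto
    show "fst e \<noteq> snd e"
      using e xy pair_no_loops[of e] by auto
  next
    show "finite (pverts (add_edge G x y))" "finite (parcs (add_edge G x y))"
      by (simp_all add: arcs verts pair_finite_verts pair_finite_arcs)
    show "symmetric (with_proj (add_edge G x y))"
      unfolding symmetric_def with_proj_simps arcs
      by (rule symI) (blast intro: arcs_symmetric)
  qed
qed

lemma closure_steps_invariants:
  assumes "(closure_step k)\<^sup>*\<^sup>* G H" "pair_graph G"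
  shows "pair_graph H \<and> pverts H = pverts G \<and> parcs G \<subseteq> parcs H"
  using assms(1)
proof (induction rule: rtranclp_induct)
  case base
  then show ?case using assms(2) by simp
next
  case (step H1 H2)
  then obtain x y where "nonadjacent H1 x y" "H2 = add_edge H1 x y"
    by (auto simp: closure_step_def)
  with step.IH pair_graph_add_edge show ?case
    by (auto simp: add_edge_def)
qed

lemma degree_mono:
  assumes "pair_graph H" "parcs G \<subseteq> parcs H"
  shows "degree G x \<le> degree H x"
proof -
  interpret H: pair_graph H by fact
  show ?thesis
    unfolding degree_def out_degree_def out_arcs_def
    using assms(2) H.pair_finite_arcs by (intro card_mono) auto
qed

lemma closure_steps_subset:
  assumes "(closure_step k)\<^sup>*\<^sup>* G H'" "is_closure k G H" "pair_graph G"
  shows "parcs H' \<subseteq> parcs H"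
  using assms(1)
proof (induction rule: rtranclp_induct)
  case base
  then show ?case
    using assms(2,3) closure_steps_invariants[of k G H] by (simp add: is_closure_def)
next
  case (step H1 H2)
  obtain x y where xy: "nonadjacent H1 x y" "k \<le> degree H1 x + degree H1 y" "H2 = add_edge H1 x y"
    using step.hyps by (auto simp: closure_step_def)
  have H: "pair_graph H" "pverts H = pverts H1"
    using assms(2,3) step.hyps(1) closure_steps_invariants[of k G H]
      closure_steps_invariants[of k G H1] by (simp_all add: is_closure_def)
  have deg: "k \<le> degree H x + degree H y" "k \<le> degree H y + degree H x"
    using xy(2) degree_mono[OF H(1) step.IH, of x] degree_mono[OF H(1) step.IH, of y] by simp_all
  have "\<not> nonadjacent H x y" "\<not> nonadjacent H y x"
    using assms(2) deg unfolding is_closure_def closure_step_def by blast+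
  then have "(x, y) \<in> parcs H" "(y, x) \<in> parcs H"
    using xy(1) H(2) by (auto simp: nonadjacent_def)
  with step.IH xy(3) show ?case by (auto simp: add_edge_def)
qed

lemma ex_is_closure:
  assumes "pair_graph G"
  shows "\<exists>H. is_closure k G H"
  using assms
proof (induction "card (pverts G \<times> pverts G - parcs G)" arbitrary: G rule: less_induct)
  case less
  interpret pair_graph G by fact
  show ?case
  proof (cases "\<exists>H. closure_step k G H")
    case False
    then show ?thesis by (auto simp: is_closure_def)
  next
    case True
    then obtain H x y where H: "closure_step k G H" "nonadjacent G x y" "H = add_edge G x y"
      unfolding closure_step_def by blast
    have "pverts H \<times> pverts H - parcs H \<subset> pverts G \<times> pverts G - parcs G"
      unfolding H(3) using H(2) by (auto simp: nonadjacent_def add_edge_def)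
    then have "card (pverts H \<times> pverts H - parcs H) < card (pverts G \<times> pverts G - parcs G)"
      by (intro psubset_card_mono) (simp_all add: pair_finite_verts)
    moreover have "pair_graph H"
      unfolding H(3) using less.prems H(2) by (rule pair_graph_add_edge)
    ultimately have "\<exists>K. is_closure k H K"
      by (rule less.hyps)
    then obtain K where "is_closure k H K" ..
    then have "is_closure k G K"
      using converse_rtranclp_into_rtranclp[of "closure_step k", OF H(1)]
      by (simp add: is_closure_def)
    then show ?thesis ..
  qed
qed

lemma ex1_is_closure:
  assumes "pair_graph G"
  shows "\<exists>!H. is_closure k G H"
proof (rule ex_ex1I)
  show "\<exists>H. is_closure k G H" using assms by (rule ex_is_closure)
next
  fix H H' assume *: "is_closure k G H" "is_closure k G H'"
  then have "parcs H = parcs H'"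
    using assms closure_steps_subset[of k G H H'] closure_steps_subset[of k G H' H]
    by (simp add: is_closure_def subset_antisym)
  moreover have "pverts H = pverts H'"
    using * assms closure_steps_invariants[of k G H] closure_steps_invariants[of k G H']
    by (simp add: is_closure_def)
  ultimately show "H = H'" by simp
qed

lemma is_closure_Cl:
  assumes "pair_graph G"
  shows "is_closure k G (Cl k G)"
  unfolding Cl_def using ex1_is_closure[OF assms] by (rule theI')

end

theory Submission
  imports Defs
begin

text \<open>
  In \<open>H = Cl n G\<close> every non-adjacent pair has degree sum exactly \<open>n - 1\<close>, and 2-connectedness forces
  both degrees to be \<open>(n - 1) / 2\<close>. If \<open>H\<close> is not complete, \<open>n\<close> is therefore odd. Adding any edge
  \<open>xy\<close> to \<open>H\<close> then starts an avalanche: \<open>x\<close> is joined to all vertices, so its \<open>(n - 1) / 2\<close> former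
  non-neighbours gain degree and are joined to all vertices as well, after which every vertex has
  degree above \<open>(n - 1) / 2\<close>. Hence the closure of \<open>H + xy\<close> is complete, and \<open>H + xy\<close> is
  hamiltonian by the Bondy--Chvatal theorem.

  For the long cycle, Ore's theorem applied to the cone over \<open>G\<close> gives a Hamiltonian path
  \<open>x\<^sub>1 \<dots> x\<^sub>n\<close> of \<open>G\<close>. Counting at its ends, for each \<open>i < n\<close> exactly one of \<open>x\<^sub>1 x\<^sub>i\<^sub>+\<^sub>1\<close> and
  \<open>x\<^sub>i x\<^sub>n\<close> is an edge unless \<open>G\<close> is hamiltonian. Either \<open>x\<^sub>1 x\<^sub>i\<^sub>+\<^sub>2\<close> and \<open>x\<^sub>i x\<^sub>n\<close> are edges for some
  \<open>i\<close>, which gives a cycle missing only \<open>x\<^sub>i\<^sub>+\<^sub>1\<close>, or \<open>x\<^sub>1\<close> is joined exactly to \<open>x\<^sub>2 \<dots> x\<^sub>j\<close> and \<open>x\<^sub>n\<close>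
  exactly to \<open>x\<^sub>j \<dots> x\<^sub>n\<^sub>-\<^sub>1\<close>; in the latter case an edge bypassing \<open>x\<^sub>j\<close> yields a Hamiltonian cycle.
\<close>

section \<open>Vertex paths and cycles\<close>

text \<open>Vertex lists replace arc lists so that cycles can be built by cutting and reversing
  lists. Over a bare relation \<open>E\<close>, an edge can be added or dropped without changing the
  list.\<close>

definition vertex_path :: "'a rel \<Rightarrow> 'a list \<Rightarrow> bool" where
  "vertex_path E xs \<longleftrightarrow> distinct xs \<and> successively (\<lambda>a b. (a, b) \<in> E) xs"

definition vertex_cycle :: "'a rel \<Rightarrow> 'a list \<Rightarrow> bool" where
  "vertex_cycle E xs \<longleftrightarrow> 3 \<le> length xs \<and> vertex_path E xs \<and> (last xs, hd xs) \<in> E"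

text \<open>\<open>zip (u # xs) (xs @ [v])\<close> is the arc list of the walk through
  \<open>u\<close>, then \<open>xs\<close>, then \<open>v\<close>; taking \<open>v = u\<close>
  closes up a vertex cycle.\<close>

lemma pcas_zip: "pcas u (zip (u # xs) (xs @ [v])) v"
  by (induction xs arbitrary: u) auto

lemma pawalk_verts_pcas: "pcas u p v \<Longrightarrow> pawalk_verts u p = map fst p @ [v]"
  by (induction p arbitrary: u) auto

lemma zip_subset_iff_successively:
  "set (zip (u # xs) (xs @ [v])) \<subseteq> E \<longleftrightarrow> successively (\<lambda>a b. (a, b) \<in> E) (u # xs @ [v])"
  by (induction xs arbitrary: u) auto

lemma pcas_successively:
  "pcas u p v \<Longrightarrow> set p \<subseteq> E \<Longrightarrow> successively (\<lambda>a b. (a, b) \<in> E) (map fst p @ [v])"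
proof (induction p arbitrary: u)
  case (Cons e p)
  then show ?case by (cases p; cases e) auto
qed simp

lemma graph_cycle_iff:
  "graph_cycle G p \<longleftrightarrow>
     (\<exists>u. u \<in> pverts G \<and> set p \<subseteq> parcs G \<and> pcas u p u \<and> distinct (tl (pawalk_verts u p))) \<and>
     3 \<le> length p"
  unfolding graph_cycle_def pre_digraph.cycle_def pre_digraph.awalk_def
    cas_with_proj_eq awalk_verts_with_proj_eq with_proj_simps by (cases "p = []") simp_all

lemma graph_cycle_of_vertex_cycle:
  assumes "pair_graph G" "vertex_cycle (parcs G) xs"
  obtains p where "graph_cycle G p" "map fst p = xs"
proof -
  interpret pair_graph G by fact
  obtain u ys where xs: "xs = u # ys" and ys: "ys \<noteq> []"
    using assms(2) by (cases xs; cases "tl xs") (auto simp: vertex_cycle_def)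
  let ?p = "zip (u # ys) (ys @ [u])"
  have fst: "map fst ?p = xs" by (simp add: xs)
  have "successively (\<lambda>a b. (a, b) \<in> parcs G) (u # ys @ [u])"
    using assms(2) ys unfolding vertex_cycle_def vertex_path_def xs
    by (auto simp: successively_append_iff successively_Cons)
  then have arcs: "set ?p \<subseteq> parcs G"
    unfolding zip_subset_iff_successively .
  have "(u, hd ys) \<in> parcs G"
    using assms(2) ys by (auto simp: vertex_cycle_def vertex_path_def xs successively_Cons)
  then have u: "u \<in> pverts G" by (rule in_arcsD1)
  have "distinct (tl (pawalk_verts u ?p))"
    using assms(2) unfolding pawalk_verts_pcas[OF pcas_zip] fst
    by (auto simp: xs vertex_cycle_def vertex_path_def)
  moreover have "3 \<le> length ?p"
    using assms(2) by (simp add: vertex_cycle_def xs)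
  ultimately have "graph_cycle G ?p"
    unfolding graph_cycle_iff using u arcs pcas_zip by (intro conjI exI[of _ u])
  then show ?thesis using fst by (rule that)
qed

lemma vertex_cycle_of_graph_cycle:
  assumes "graph_cycle G p"
  shows "vertex_cycle (parcs G) (map fst p)"
proof -
  obtain u where u: "set p \<subseteq> parcs G" "pcas u p u" "distinct (tl (pawalk_verts u p))"
    and len: "3 \<le> length p"
    using assms unfolding graph_cycle_iff by blast
  obtain e es where p: "p = e # es" using len by (cases p) auto
  have e: "fst e = u" using u(2) by (simp add: p)
  \<comment> \<open>The closed walk lists \<open>u\<close> at both ends: \<open>tl\<close> drops the
    first occurrence, \<open>map fst\<close> the last.\<close>
  have "distinct (map fst p)"
    using u(3) unfolding pawalk_verts_pcas[OF u(2)] by (auto simp: p e)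
  moreover have "successively (\<lambda>a b. (a, b) \<in> parcs G) (map fst p)"
    "(last (map fst p), hd (map fst p)) \<in> parcs G"
    using pcas_successively[OF u(2,1)] unfolding successively_append_iff by (auto simp: p e)
  ultimately show ?thesis
    using len by (simp add: vertex_cycle_def vertex_path_def)
qed

lemma hamiltonian_iff:
  assumes "pair_graph G"
  shows "hamiltonian G \<longleftrightarrow> (\<exists>xs. vertex_cycle (parcs G) xs \<and> set xs = pverts G)"
proof
  assume "hamiltonian G"
  then obtain p where "graph_cycle G p" "fst ` set p = pverts G"
    by (auto simp: hamiltonian_def)
  then show "\<exists>xs. vertex_cycle (parcs G) xs \<and> set xs = pverts G"
    using vertex_cycle_of_graph_cycle[of G p] by (intro exI[of _ "map fst p"]) auto
next
  assume "\<exists>xs. vertex_cycle (parcs G) xs \<and> set xs = pverts G"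
  then obtain xs where xs: "vertex_cycle (parcs G) xs" "set xs = pverts G" by blast
  obtain p where "graph_cycle G p" "map fst p = xs"
    using graph_cycle_of_vertex_cycle[OF assms xs(1)] .
  then show "hamiltonian G"
    using xs(2) by (auto simp: hamiltonian_def)
qed

section \<open>Rotating and rerouting cycles\<close>

lemma vertex_cycle_rotate:
  assumes "vertex_cycle E (us @ vs)"
  shows "vertex_cycle E (vs @ us)"
proof (cases "us = [] \<or> vs = []")
  case False
  then show ?thesis
    using assms by (auto simp: vertex_cycle_def vertex_path_def successively_append_iff)
qed (use assms in auto)

text \<open>Traverse \<open>us\<close>, jump to the end of \<open>vs\<close>, run \<open>vs\<close>
  backwards and return to the head of \<open>us\<close>. The block \<open>ws\<close> is skipped: it
  is empty for a Hamiltonian cycle and a single vertex for a cycle missing one vertex.\<close>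

lemma vertex_cycle_crossing:
  assumes "sym E" "vertex_path E (us @ ws @ vs)" "us \<noteq> []" "vs \<noteq> []"
    and "(hd us, hd vs) \<in> E" "(last us, last vs) \<in> E" "3 \<le> length us + length vs"
  shows "vertex_cycle E (us @ rev vs)"
proof -
  have "successively (\<lambda>a b. (b, a) \<in> E) vs"
    using assms(2) by (auto simp: vertex_path_def successively_append_iff
        elim: successively_mono intro: symD[OF assms(1)])
  moreover have "(hd vs, hd us) \<in> E" using assms(1,5) by (rule symD)
  ultimately show ?thesis
    using assms(2-4,6,7) by (auto simp: vertex_cycle_def vertex_path_def successively_append_iff
        hd_rev last_rev)
qed

text \<open>No vertex is lost here: traverse \<open>us\<close>, jump over \<open>vs\<close> to
  \<open>ws\<close>, jump from the end of \<open>ws\<close> to the end of \<open>vs\<close>, and run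
  \<open>vs\<close> backwards to its head, which is joined to the head of \<open>us\<close>.\<close>

lemma vertex_cycle_double_crossing:
  assumes "sym E" "vertex_path E (us @ vs @ ws)" "us \<noteq> []" "vs \<noteq> []" "ws \<noteq> []"
    and "(hd us, hd vs) \<in> E" "(last us, hd ws) \<in> E" "(last vs, last ws) \<in> E"
  shows "vertex_cycle E (us @ ws @ rev vs)"
proof -
  have "successively (\<lambda>a b. (b, a) \<in> E) vs"
    using assms(2) by (auto simp: vertex_path_def successively_append_iff
        elim: successively_mono intro: symD[OF assms(1)])
  moreover have "3 \<le> length us + length vs + length ws"
    using assms(3-5) by (cases us; cases vs; cases ws) auto
  moreover have "(hd vs, hd us) \<in> E" "(last ws, last vs) \<in> E"
    using symD[OF assms(1)] assms(6,8) by blast+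
  ultimately show ?thesis
    using assms(2-5,7) by (auto simp: vertex_cycle_def vertex_path_def successively_append_iff
        hd_rev last_rev)
qed

section \<open>Degrees\<close>

lemma degree_eq_card_Image: "degree G x = card (parcs G `` {x})"
proof -
  have "out_arcs (with_proj G) x = Pair x ` (parcs G `` {x})"
    by (auto simp: out_arcs_def)
  then show ?thesis
    by (simp add: degree_def out_degree_def card_image inj_on_def)
qed

context pair_graph
begin

lemma sym_parcs: "sym (parcs G)"
  by (rule symI) (rule arcs_symmetric)

lemma no_loop: "(x, x) \<notin> parcs G"
  using pair_no_loops[of "(x, x)"] by auto

lemma parcs_commute: "(x, y) \<in> parcs G \<longleftrightarrow> (y, x) \<in> parcs G"
  using arcs_symmetric by blast

lemma finite_neighbours: "finite (parcs G `` {x})"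
  using pair_finite_arcs by (rule finite_Image)

lemma nonadjacent_sym: "nonadjacent G x y \<Longrightarrow> nonadjacent G y x"
  by (auto simp: nonadjacent_def parcs_commute[of y x])

lemma finite_nonadjacent: "finite {y. nonadjacent G x y}"
  by (rule finite_subset[OF _ pair_finite_verts]) (auto simp: nonadjacent_def)

lemma degree_nonadjacent:
  assumes "x \<in> pverts G"
  shows "degree G x + card {y. nonadjacent G x y} + 1 = card (pverts G)"
proof -
  have "pverts G = insert x (parcs G `` {x} \<union> {y. nonadjacent G x y})"
    using assms by (auto simp: nonadjacent_def dest: in_arcsD2)
  moreover have "x \<notin> parcs G `` {x} \<union> {y. nonadjacent G x y}"
    by (auto simp: nonadjacent_def no_loop)
  moreover have "parcs G `` {x} \<inter> {y. nonadjacent G x y} = {}"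
    by (auto simp: nonadjacent_def)
  ultimately have "card (pverts G) = Suc (card (parcs G `` {x}) + card {y. nonadjacent G x y})"
    using finite_neighbours finite_nonadjacent by (metis card_Un_disjoint card_insert_disjoint finite_UnI)
  then show ?thesis by (simp add: degree_eq_card_Image)
qed

lemma complete_hamiltonian:
  assumes "\<And>x y. \<not> nonadjacent G x y" "3 \<le> card (pverts G)"
  shows "hamiltonian G"
proof -
  obtain xs where xs: "set xs = pverts G" "distinct xs"
    using finite_distinct_list[OF pair_finite_verts] by blast
  have adj: "(a, b) \<in> parcs G" if "a \<in> set xs" "b \<in> set xs" "a \<noteq> b" for a b
    using assms(1)[of a b] that xs(1) by (auto simp: nonadjacent_def)
  have len: "3 \<le> length xs" using assms(2) xs distinct_card[of xs] by simp
  have "successively (\<lambda>a b. (a, b) \<in> parcs G) xs"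
    unfolding successively_conv_nth using xs(2)
    by (auto intro!: adj simp: nth_eq_iff_index_eq)
  moreover have "(last xs, hd xs) \<in> parcs G"
    using len xs(2) by (cases xs) (auto intro!: adj)
  ultimately have "vertex_cycle (parcs G) xs"
    using len xs(2) by (simp add: vertex_cycle_def vertex_path_def)
  then show ?thesis
    using xs(1) hamiltonian_iff[OF pair_graph_axioms] by blast
qed

end

section \<open>The ends of a Hamiltonian path\<close>

context pair_graph
begin

text \<open>Here and for the last vertex, \<open>i\<close> stands for the path edge from
  \<open>xs ! i\<close> to \<open>xs ! Suc i\<close>, so the neighbours of both ends are counted
  inside one set of indices.\<close>

lemma degree_hd_conv_nth:
  assumes "distinct xs" "set xs = pverts G" "xs \<noteq> []"
  shows "degree G (hd xs) = card {i. Suc i < length xs \<and> (hd xs, xs ! Suc i) \<in> parcs G}"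
proof -
  let ?S = "{i. Suc i < length xs \<and> (hd xs, xs ! Suc i) \<in> parcs G}"
  have inj: "inj_on (\<lambda>i. xs ! Suc i) ?S"
    using assms(1) by (auto simp: inj_on_def nth_eq_iff_index_eq)
  have "(\<lambda>i. xs ! Suc i) ` ?S = parcs G `` {hd xs}"
  proof (intro equalityI subsetI)
    fix z assume z: "z \<in> parcs G `` {hd xs}"
    then have "z \<in> set xs" using assms(2) by (auto dest: in_arcsD2)
    then obtain j where j: "j < length xs" "z = xs ! j"
      by (auto simp: in_set_conv_nth)
    have "j \<noteq> 0"
      using z j assms(3) no_loop by (cases "j = 0") (auto simp: hd_conv_nth)
    then show "z \<in> (\<lambda>i. xs ! Suc i) ` ?S"
      using z j by (intro image_eqI[of _ _ "j - 1"]) auto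
  qed auto
  with card_image[OF inj] show ?thesis
    unfolding degree_eq_card_Image by simp
qed

lemma degree_last_conv_nth:
  assumes "distinct xs" "set xs = pverts G" "xs \<noteq> []"
  shows "degree G (last xs) = card {i. Suc i < length xs \<and> (xs ! i, last xs) \<in> parcs G}"
proof -
  let ?T = "{i. Suc i < length xs \<and> (xs ! i, last xs) \<in> parcs G}"
  have inj: "inj_on (\<lambda>i. xs ! i) ?T"
    using assms(1) by (auto simp: inj_on_def nth_eq_iff_index_eq)
  have "(\<lambda>i. xs ! i) ` ?T = parcs G `` {last xs}"
  proof (intro equalityI subsetI)
    fix z assume z: "z \<in> parcs G `` {last xs}"
    then have "z \<in> set xs" using assms(2) by (auto dest: in_arcsD2)
    then obtain j where j: "j < length xs" "z = xs ! j"
      by (auto simp: in_set_conv_nth)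
    have "j \<noteq> length xs - 1"
      using z j assms(3) by (auto simp: last_conv_nth no_loop)
    then show "z \<in> (\<lambda>i. xs ! i) ` ?T"
      using z j parcs_commute[of z] by (intro image_eqI[of _ _ j]) auto
  qed (use arcs_symmetric in blast)
  with card_image[OF inj] show ?thesis
    unfolding degree_eq_card_Image by simp
qed

text \<open>The bound on \<open>3 + j\<close> says that at least three vertices remain once those
  strictly between positions \<open>i\<close> and \<open>j\<close> are skipped.\<close>

lemma crossing_cycle_nth:
  assumes "vertex_path (parcs G) xs" "i < j" "j < length xs" "3 + j \<le> length xs + Suc i"
    and "(hd xs, xs ! j) \<in> parcs G" "(xs ! i, last xs) \<in> parcs G"
  shows "vertex_cycle (parcs G) (take (Suc i) xs @ rev (drop j xs))"
proof (rule vertex_cycle_crossing[OF sym_parcs])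
  have "drop (Suc i) xs = take (j - Suc i) (drop (Suc i) xs) @ drop j xs"
    using append_take_drop_id[of "j - Suc i" "drop (Suc i) xs"] assms(2) by simp
  then have "take (Suc i) xs @ take (j - Suc i) (drop (Suc i) xs) @ drop j xs = xs"
    by (metis append_take_drop_id)
  then show "vertex_path (parcs G) (take (Suc i) xs @ take (j - Suc i) (drop (Suc i) xs) @ drop j xs)"
    using assms(1) by simp
  show "take (Suc i) xs \<noteq> []" "drop j xs \<noteq> []" using assms(3) by auto
  show "(hd (take (Suc i) xs), hd (drop j xs)) \<in> parcs G"
    using assms(3,5) by (simp add: hd_drop_conv_nth)
  show "(last (take (Suc i) xs), last (drop j xs)) \<in> parcs G"
    using assms(2,3,6) by (simp add: take_Suc_conv_app_nth)
  show "3 \<le> length (take (Suc i) xs) + length (drop j xs)"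
    using assms(2-4) by simp
qed

text \<open>An index common to \<open>?S\<close> and \<open>?T\<close> gives two crossing chords,
  hence a Hamiltonian cycle. So the end degrees count disjoint subsets of the
  \<open>length xs - 1\<close> path edges; if their sum reaches that number, each path edge lies in
  exactly one subset.\<close>

lemma nonhamiltonian_path_ends:
  assumes "\<not> hamiltonian G" "vertex_path (parcs G) xs" "set xs = pverts G" "3 \<le> length xs"
  shows "degree G (hd xs) + degree G (last xs) < length xs"
    and "\<lbrakk>length xs \<le> degree G (hd xs) + degree G (last xs) + 1; Suc i < length xs\<rbrakk> \<Longrightarrow>
      (hd xs, xs ! Suc i) \<in> parcs G \<longleftrightarrow> (xs ! i, last xs) \<notin> parcs G"
proof -
  let ?S = "{i. Suc i < length xs \<and> (hd xs, xs ! Suc i) \<in> parcs G}"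
  let ?T = "{i. Suc i < length xs \<and> (xs ! i, last xs) \<in> parcs G}"
  have ne: "xs \<noteq> []" and dist: "distinct xs"
    using assms(2,4) by (auto simp: vertex_path_def)
  have disj: "(xs ! i, last xs) \<notin> parcs G"
    if "Suc i < length xs" "(hd xs, xs ! Suc i) \<in> parcs G" for i
  proof
    assume "(xs ! i, last xs) \<in> parcs G"
    then have "vertex_cycle (parcs G) (take (Suc i) xs @ rev (drop (Suc i) xs))"
      using that assms(2,4) by (intro crossing_cycle_nth) auto
    moreover have "set (take (Suc i) xs @ rev (drop (Suc i) xs)) = pverts G"
      using assms(3) by (metis append_take_drop_id set_append set_rev)
    ultimately show False
      using assms(1) hamiltonian_iff[OF pair_graph_axioms] by blast
  qed
  have sub: "?S \<union> ?T \<subseteq> {..<length xs - 1}" by auto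
  have card: "card (?S \<union> ?T) = degree G (hd xs) + degree G (last xs)"
    using disj unfolding degree_hd_conv_nth[OF dist assms(3) ne] degree_last_conv_nth[OF dist assms(3) ne]
    by (intro card_Un_disjoint finite_subset[OF _ finite_lessThan[of "length xs"]]) auto
  show "degree G (hd xs) + degree G (last xs) < length xs"
    using card_mono[OF _ sub] card assms(4) by simp
  show "(hd xs, xs ! Suc i) \<in> parcs G \<longleftrightarrow> (xs ! i, last xs) \<notin> parcs G"
    if "length xs \<le> degree G (hd xs) + degree G (last xs) + 1" "Suc i < length xs"
  proof -
    have "?S \<union> ?T = {..<length xs - 1}"
      using that card by (intro card_seteq[OF _ sub]) auto
    then have "i \<in> ?S \<union> ?T" using that(2) by auto
    then show ?thesis using disj[of i] by blast
  qed
qed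

end

section \<open>The Bondy--Chvatal closure\<close>

text \<open>Cut the cycle at the new edge: what remains is a path in \<open>E\<close> joining
  \<open>x\<close> and \<open>y\<close>.\<close>

lemma vertex_cycle_add_edge:
  assumes "vertex_cycle (E \<union> {(x, y), (y, x)}) xs" "\<not> vertex_cycle E xs"
  obtains ys where "vertex_path E ys" "set ys = set xs" "length ys = length xs"
    "(hd ys, last ys) \<in> {(x, y), (y, x)}"
proof -
  let ?E = "E \<union> {(x, y), (y, x)}"
  have "\<exists>ys. vertex_cycle ?E ys \<and> set ys = set xs \<and> length ys = length xs \<and> (last ys, hd ys) \<notin> E"
  proof (cases "(last xs, hd xs) \<in> E")
    case True
    with assms have "\<not> successively (\<lambda>a b. (a, b) \<in> E) xs"
      by (auto simp: vertex_cycle_def vertex_path_def)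
    then obtain i where i: "Suc i < length xs" "(xs ! i, xs ! Suc i) \<notin> E"
      by (auto simp: successively_conv_nth)
    \<comment> \<open>The rotation moves the pair outside \<open>E\<close> to the closing
      position.\<close>
    let ?ys = "drop (Suc i) xs @ take (Suc i) xs"
    have "vertex_cycle ?E ?ys"
      by (rule vertex_cycle_rotate) (use assms(1) in simp)
    moreover have "set ?ys = set xs"
      using set_append[of "take (Suc i) xs" "drop (Suc i) xs"] by auto
    moreover have "length ?ys = length xs" by simp
    moreover have "(last ?ys, hd ?ys) \<notin> E"
      using i by (simp add: hd_drop_conv_nth take_Suc_conv_app_nth)
    ultimately show ?thesis by blast
  qed (use assms in blast)
  then obtain ys where ys: "vertex_cycle ?E ys" "set ys = set xs" "length ys = length xs"
    "(last ys, hd ys) \<notin> E" by blast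
  have len: "3 \<le> length ys" and dist: "distinct ys" and ne: "ys \<noteq> []"
    using ys(1) by (auto simp: vertex_cycle_def vertex_path_def)
  have ends: "(last ys, hd ys) = (x, y) \<or> (last ys, hd ys) = (y, x)"
    using ys(1,4) by (auto simp: vertex_cycle_def)
  have "(ys ! i, ys ! Suc i) \<in> E" if i: "Suc i < length ys" for i
  proof (rule ccontr)
    assume "(ys ! i, ys ! Suc i) \<notin> E"
    moreover have "(ys ! i, ys ! Suc i) \<in> ?E"
      using ys(1) i by (auto simp: vertex_cycle_def vertex_path_def successively_conv_nth)
    \<comment> \<open>A second missing edge would join the same two vertices, the first and the last
      of \<open>ys\<close>; in a distinct list of length at least 3 these are not
      consecutive.\<close>
    ultimately have "ys ! i = ys ! 0 \<and> ys ! Suc i = ys ! (length ys - 1) \<or>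
        ys ! Suc i = ys ! 0 \<and> ys ! i = ys ! (length ys - 1)"
      using ends ne by (auto simp: hd_conv_nth last_conv_nth)
    then show False
      using i len dist
      by (cases "length ys"; cases i) (auto simp: nth_eq_iff_index_eq)
  qed
  then have "vertex_path E ys"
    using dist by (simp add: vertex_path_def successively_conv_nth)
  then show ?thesis using ys ends that by blast
qed

text \<open>Otherwise a Hamiltonian cycle through the new edge leaves a Hamiltonian path of
  \<open>G\<close> between \<open>x\<close> and \<open>y\<close>, whose end degrees sum to less than
  the order.\<close>

lemma hamiltonian_add_edge:
  assumes "pair_graph G" "nonadjacent G x y" "hamiltonian (add_edge G x y)"
    and "card (pverts G) \<le> degree G x + degree G y"
  shows "hamiltonian G"
proof (rule ccontr)
  assume nh: "\<not> hamiltonian G"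
  interpret pair_graph G by fact
  have arcs: "parcs (add_edge G x y) = parcs G \<union> {(x, y), (y, x)}"
    and verts: "pverts (add_edge G x y) = pverts G"
    by (auto simp: add_edge_def)
  obtain xs where xs: "vertex_cycle (parcs G \<union> {(x, y), (y, x)}) xs" "set xs = pverts G"
    using assms(3) unfolding hamiltonian_iff[OF pair_graph_add_edge[OF assms(1,2)]] arcs verts by blast
  have "\<not> vertex_cycle (parcs G) xs"
    using nh xs(2) hamiltonian_iff[OF assms(1)] by blast
  from vertex_cycle_add_edge[OF xs(1) this] obtain ys where
    ys: "vertex_path (parcs G) ys" "set ys = set xs" "length ys = length xs"
      "(hd ys, last ys) \<in> {(x, y), (y, x)}" .
  have "3 \<le> length ys" using xs(1) ys(3) by (simp add: vertex_cycle_def)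
  then have "degree G (hd ys) + degree G (last ys) < length ys"
    using nonhamiltonian_path_ends(1)[OF nh ys(1)] ys(2) xs(2) by simp
  moreover have "length ys = card (pverts G)"
    using ys(1,2) xs(2) distinct_card[of ys] by (simp add: vertex_path_def)
  ultimately show False using ys(4) assms(4) by auto
qed

lemma hamiltonian_closure_steps:
  assumes "(closure_step k)\<^sup>*\<^sup>* G H" "pair_graph G" "card (pverts G) \<le> k" "hamiltonian H"
  shows "hamiltonian G"
  using assms(1,4)
proof (induction rule: rtranclp_induct)
  case (step H1 H2)
  obtain x y where "nonadjacent H1 x y" "k \<le> degree H1 x + degree H1 y" "H2 = add_edge H1 x y"
    using step.hyps by (auto simp: closure_step_def)
  then have "hamiltonian H1"
    using closure_steps_invariants[OF step.hyps(1) assms(2)] assms(3) step.prems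
    by (intro hamiltonian_add_edge[of H1 x y]) auto
  then show ?case by (rule step.IH)
qed

lemma
  assumes "pair_graph G"
  shows pair_graph_Cl: "pair_graph (Cl k G)"
    and pverts_Cl: "pverts (Cl k G) = pverts G"
    and parcs_subset_Cl: "parcs G \<subseteq> parcs (Cl k G)"
    and degree_Cl_nonadjacent:
      "nonadjacent (Cl k G) x y \<Longrightarrow> degree (Cl k G) x + degree (Cl k G) y < k"
proof -
  have steps: "(closure_step k)\<^sup>*\<^sup>* G (Cl k G)" and closed: "\<not> (\<exists>H'. closure_step k (Cl k G) H')"
    using is_closure_Cl[OF assms, of k] by (simp_all add: is_closure_def)
  show "pair_graph (Cl k G)" "pverts (Cl k G) = pverts G" "parcs G \<subseteq> parcs (Cl k G)"
    using closure_steps_invariants[OF steps assms] by simp_all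
  show "degree (Cl k G) x + degree (Cl k G) y < k" if "nonadjacent (Cl k G) x y"
  proof (rule ccontr)
    assume "\<not> ?thesis"
    then have "closure_step k (Cl k G) (add_edge (Cl k G) x y)"
      unfolding closure_step_def using that by (intro exI[of _ x] exI[of _ y]) simp
    with closed show False by blast
  qed
qed

lemma hamiltonian_Cl:
  assumes "pair_graph G" "card (pverts G) \<le> k" "hamiltonian (Cl k G)"
  shows "hamiltonian G"
  using is_closure_Cl[OF assms(1), of k] hamiltonian_closure_steps[OF _ assms]
  by (simp add: is_closure_def)

lemma hamiltonian_if_Cl_complete:
  assumes "pair_graph G" "3 \<le> card (pverts G)"
    and "\<And>x y. \<not> nonadjacent (Cl (card (pverts G)) G) x y"
  shows "hamiltonian G"
  using assms(2) hamiltonian_Cl[OF assms(1) order_refl]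
    pair_graph.complete_hamiltonian[OF pair_graph_Cl[OF assms(1)] assms(3)]
  unfolding pverts_Cl[OF assms(1)] by blast

text \<open>The closure keeps the vertices and only adds edges: a pair non-adjacent in it is
  non-adjacent in \<open>G\<close>, and degrees do not drop.\<close>

lemma Cl_nonadjacent_degree_ge:
  assumes "pair_graph G" "nonadjacent (Cl k G) x y"
    and "\<And>x y. nonadjacent G x y \<Longrightarrow> m \<le> degree G x + degree G y"
  shows "m \<le> degree (Cl k G) x + degree (Cl k G) y"
proof -
  have "nonadjacent G x y"
    using assms(1,2) parcs_subset_Cl[OF assms(1), of k] pverts_Cl[OF assms(1), of k]
    by (auto simp: nonadjacent_def)
  moreover note H = pair_graph_Cl[OF assms(1), of k] parcs_subset_Cl[OF assms(1), of k]
  ultimately show ?thesis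
    using assms(3)[of x y] add_mono[OF degree_mono[OF H, of x] degree_mono[OF H, of y]]
    by linarith
qed

text \<open>A pair non-adjacent in the closure would have degree sum both below the order and at
  least the order, so the closure is complete.\<close>

lemma Ore:
  assumes "pair_graph G" "3 \<le> card (pverts G)"
    and "\<And>x y. nonadjacent G x y \<Longrightarrow> card (pverts G) \<le> degree G x + degree G y"
  shows "hamiltonian G"
proof (rule hamiltonian_if_Cl_complete[OF assms(1,2)])
  fix x y
  show "\<not> nonadjacent (Cl (card (pverts G)) G) x y"
    using degree_Cl_nonadjacent[OF assms(1)] Cl_nonadjacent_degree_ge[OF assms(1) _ assms(3)]
    by (meson not_le)
qed

section \<open>Hamiltonian paths\<close>

text \<open>The fresh apex \<open>None\<close> is joined to every vertex. The order and each old
  degree rise by one, so a degree sum of \<open>n - 1\<close> becomes \<open>n + 1\<close>, the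
  order of the cone.\<close>

definition cone :: "'a pair_pre_digraph \<Rightarrow> 'a option pair_pre_digraph" where
  "cone G = \<lparr>pverts = insert None (Some ` pverts G),
     parcs = map_prod Some Some ` parcs G \<union> {None} \<times> Some ` pverts G \<union> Some ` pverts G \<times> {None}\<rparr>"

lemma pverts_cone [simp]: "pverts (cone G) = insert None (Some ` pverts G)"
  by (simp add: cone_def)

lemma parcs_cone_iff [simp]:
  "(Some x, Some y) \<in> parcs (cone G) \<longleftrightarrow> (x, y) \<in> parcs G"
  "(None, Some y) \<in> parcs (cone G) \<longleftrightarrow> y \<in> pverts G"
  "(Some x, None) \<in> parcs (cone G) \<longleftrightarrow> x \<in> pverts G"
  "(None, None) \<notin> parcs (cone G)"
  by (auto simp: cone_def)

lemma pair_graph_cone: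
  assumes "pair_graph G"
  shows "pair_graph (cone G)"
proof -
  interpret pair_graph G by fact
  show ?thesis
  proof
    fix e assume e: "e \<in> parcs (cone G)"
    then show "fst e \<in> pverts (cone G)" "snd e \<in> pverts (cone G)"
      by (auto simp: cone_def dest: in_arcsD1 in_arcsD2)
    show "fst e \<noteq> snd e"
      using e by (auto simp: cone_def no_loop)
  next
    show "finite (pverts (cone G))" "finite (parcs (cone G))"
      by (simp_all add: cone_def pair_finite_verts pair_finite_arcs)
    show "symmetric (with_proj (cone G))"
      unfolding symmetric_def with_proj_simps
    proof (rule symI)
      show "(b, a) \<in> parcs (cone G)" if "(a, b) \<in> parcs (cone G)" for a b
        using that by (cases a; cases b) (simp_all add: arcs_symmetric)
    qed
  qed
qed

lemma degree_cone:
  assumes "pair_graph G" "x \<in> pverts G"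
  shows "degree (cone G) (Some x) = degree G x + 1"
proof -
  interpret pair_graph G by fact
  have "parcs (cone G) `` {Some x} = insert None (Some ` (parcs G `` {x}))"
    using assms(2) by (auto simp: cone_def image_iff)
  then show ?thesis
    using finite_neighbours[of x] by (simp add: degree_eq_card_Image card_image)
qed

lemma ex_hamiltonian_path:
  assumes "pair_graph G" "2 \<le> card (pverts G)"
    and "\<And>x y. nonadjacent G x y \<Longrightarrow> card (pverts G) \<le> degree G x + degree G y + 1"
  obtains xs where "vertex_path (parcs G) xs" "set xs = pverts G"
proof -
  interpret pair_graph G by fact
  have card: "card (pverts (cone G)) = card (pverts G) + 1"
    using pair_finite_verts by (simp add: cone_def card_image)
  have "hamiltonian (cone G)"
  proof (rule Ore[OF pair_graph_cone[OF assms(1)]])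
    show "3 \<le> card (pverts (cone G))" using assms(2) card by simp
    fix a b assume ab: "nonadjacent (cone G) a b"
    then obtain x y where xy: "a = Some x" "b = Some y" "nonadjacent G x y"
      by (auto simp: nonadjacent_def cone_def)
    then have "x \<in> pverts G" "y \<in> pverts G" by (auto simp: nonadjacent_def)
    then show "card (pverts (cone G)) \<le> degree (cone G) a + degree (cone G) b"
      using assms(3)[OF xy(3)] degree_cone[OF assms(1)] unfolding xy card by simp
  qed
  then obtain cs where cs: "vertex_cycle (parcs (cone G)) cs" "set cs = pverts (cone G)"
    using hamiltonian_iff[OF pair_graph_cone[OF assms(1)]] by blast
  have "None \<in> set cs" by (simp add: cs(2))
  \<comment> \<open>Rotated to start at the apex, the cycle becomes a path of \<open>G\<close> when
    its head is removed.\<close>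
  then obtain us vs where uvs: "cs = us @ None # vs" by (metis split_list)
  define ys where "ys = vs @ us"
  have cyc: "vertex_cycle (parcs (cone G)) (None # ys)"
    using cs(1) vertex_cycle_rotate[of _ us "None # vs"] by (simp add: uvs ys_def)
  have dist: "distinct ys" "None \<notin> set ys"
    using cyc by (simp_all add: vertex_cycle_def vertex_path_def)
  have "insert None (set ys) = insert None (Some ` pverts G)"
    using cs(2) by (auto simp: uvs ys_def)
  then have set: "set ys = Some ` pverts G"
    using dist(2) by (subst (asm) insert_ident) auto
  have "successively (\<lambda>a b. (a, b) \<in> parcs (cone G)) ys"
    using cyc by (cases ys) (simp_all add: vertex_cycle_def vertex_path_def)
  then have "successively (\<lambda>a b. (the a, the b) \<in> parcs G) ys"
    by (rule successively_mono) (use set in auto)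
  moreover have "distinct (map the ys)"
    using dist set by (auto simp: distinct_map inj_on_def)
  ultimately have "vertex_path (parcs G) (map the ys)"
    by (simp add: vertex_path_def successively_map)
  moreover have "set (map the ys) = pverts G"
    unfolding set_map set by (simp add: image_image)
  ultimately show ?thesis by (rule that)
qed

section \<open>Long cycles in 2-connected graphs\<close>

text \<open>The graph stays connected without \<open>w\<close>, whereas with no edge between
  \<open>A\<close> and \<open>B\<close> a walk avoiding \<open>w\<close> that starts in
  \<open>A\<close> could never leave \<open>A\<close>.\<close>

lemma edge_across_cut_vertex:
  assumes "pair_graph G" "k_connected 2 G" "w \<in> pverts G"
    and "pverts G - {w} = A \<union> B" "A \<noteq> {}" "B \<noteq> {}" "A \<inter> B = {}"
  obtains a b where "a \<in> A" "b \<in> B" "(a, b) \<in> parcs G"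
proof (rule ccontr)
  assume "\<not> thesis"
  with that have none: "(a, b) \<notin> parcs G" if "a \<in> A" "b \<in> B" for a b
    using that by blast
  interpret pair_graph G by fact
  let ?H = "with_proj G \<restriction> (pverts G - {w})"
  have "connected ?H"
    using assms(2,3) by (auto simp: k_connected_def)
  moreover obtain a b where ab: "a \<in> A" "b \<in> B" using assms(5,6) by blast
  moreover have "a \<in> verts ?H" "b \<in> verts ?H" using ab assms(4) by auto
  ultimately have "a \<rightarrow>\<^sup>*\<^bsub>mk_symmetric ?H\<^esub> b"
    unfolding connected_def strongly_connected_def by simp
  then have "(a, b) \<in> (arcs_ends (mk_symmetric ?H))\<^sup>*"
    by (rule reachable_rtranclI)
  then have "b \<in> A"
  proof (induction rule: rtrancl_induct)
    case (step y z)
    then have "(y, z) \<in> parcs G" "z \<in> A \<union> B"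
      unfolding assms(4)[symmetric] by (auto simp: parcs_mk_symmetric intro: arcs_symmetric)
    then show ?case using step.IH none by blast
  qed (rule ab)
  then show False using ab assms(7) by blast
qed

lemma ex_long_cycle:
  assumes "pair_graph G" "k_connected 2 G" "3 \<le> card (pverts G)"
    and deg: "\<And>x y. nonadjacent G x y \<Longrightarrow> card (pverts G) \<le> degree G x + degree G y + 1"
  obtains xs where "vertex_cycle (parcs G) xs" "card (pverts G) \<le> length xs + 1"
proof (cases "hamiltonian G")
  case True
  then obtain xs where "vertex_cycle (parcs G) xs" "set xs = pverts G"
    using hamiltonian_iff[OF assms(1)] by blast
  then show ?thesis
    using that[of xs] card_length[of xs] by simp
next
  case nh: False
  interpret pair_graph G by fact
  obtain xs where xs: "vertex_path (parcs G) xs" "set xs = pverts G"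
    using ex_hamiltonian_path[OF assms(1) _ deg] assms(3) by auto
  have dist: "distinct xs" using xs(1) by (simp add: vertex_path_def)
  have len: "length xs = card (pverts G)" using distinct_card[OF dist] xs(2) by simp
  define n where "n = length xs"
  have n: "3 \<le> n" "length xs = n" "card (pverts G) = n" "3 \<le> length xs" "xs \<noteq> []"
    using len assms(3) by (auto simp: n_def)
  have hd: "hd xs = xs ! 0" and last: "last xs = xs ! (n - 1)"
    using n by (simp_all add: hd_conv_nth last_conv_nth)
  have noncyc: "\<not> vertex_cycle (parcs G) ys" if "set ys = pverts G" for ys
    using nh that hamiltonian_iff[OF assms(1)] by blast
  have ends: "(hd xs, last xs) \<notin> parcs G"
    using noncyc[OF xs(2)] xs(1) n(4) arcs_symmetric by (auto simp: vertex_cycle_def)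
  have "hd xs \<noteq> last xs"
    using n dist by (simp add: hd last nth_eq_iff_index_eq)
  then have "nonadjacent G (hd xs) (last xs)"
    using ends n(5) by (simp add: nonadjacent_def flip: xs(2))
  from deg[OF this] have complement:
    "(hd xs, xs ! Suc i) \<in> parcs G \<longleftrightarrow> (xs ! i, last xs) \<notin> parcs G" if "Suc i < n" for i
    using nonhamiltonian_path_ends(2)[OF nh xs n(4)] that n by simp
  show ?thesis
  proof (cases "\<exists>i. i + 2 < n \<and> (hd xs, xs ! (i + 2)) \<in> parcs G \<and> (xs ! i, last xs) \<in> parcs G")
    case True
    then obtain i where i: "i + 2 < n" "(hd xs, xs ! (i + 2)) \<in> parcs G" "(xs ! i, last xs) \<in> parcs G"
      by blast
    \<comment> \<open>With \<open>i\<close> positive, \<open>i + 2 < n\<close> gives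
      \<open>n\<close> at least 4, so the cycle missing one vertex still has length at least
      3.\<close>
    have "i \<noteq> 0" using i(3) ends by (cases "i = 0") (auto simp: hd)
    then have "vertex_cycle (parcs G) (take (Suc i) xs @ rev (drop (i + 2) xs))"
      using i xs(1) n by (intro crossing_cycle_nth) auto
    then show ?thesis by (rule that) (use i(1) n in auto)
  next
    case False
    \<comment> \<open>The neighbours of \<open>last xs\<close> form a final segment starting at some index \<open>j\<close>, and those of
      \<open>hd xs\<close> are the vertices at the indices from 1 to \<open>j\<close>.\<close>
    define j where "j = (LEAST i. (xs ! i, last xs) \<in> parcs G)"
    \<comment> \<open>The last path edge shows that the least index \<open>j\<close> exists and is
      at most \<open>n - 2\<close>.\<close>
    have pen: "(xs ! (n - 2), last xs) \<in> parcs G"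
    proof -
      have "Suc (n - 2) = n - 1" using n(1) by simp
      then show ?thesis
        using xs(1) n(1,2) unfolding vertex_path_def successively_conv_nth last
        by (metis diff_less less_le_trans zero_less_numeral zero_less_one)
    qed
    have j: "(xs ! j, last xs) \<in> parcs G" "j \<le> n - 2"
      unfolding j_def using pen by (rule LeastI, rule Least_le)
    have "j \<noteq> 0" using j(1) ends by (cases "j = 0") (auto simp: hd)
    have final: "(xs ! i, last xs) \<in> parcs G" if "j \<le> i" "Suc i < n" for i
      using that
    proof (induction i rule: dec_induct)
      case base
      then show ?case using j(1) by simp
    next
      case (step i)
      \<comment> \<open>The chord to \<open>i + 2\<close> is excluded by the failure of the first
        case; \<open>complement\<close> turns its absence into the edge from
        \<open>xs ! Suc i\<close> to \<open>last xs\<close>.\<close>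
      then have "(hd xs, xs ! (i + 2)) \<notin> parcs G"
        using False by auto
      then show ?case using complement[of "Suc i"] step.prems by simp
    qed
    have initial: "(hd xs, xs ! Suc i) \<in> parcs G" if "i < j" for i
      using that complement[of i] not_less_Least[of i "\<lambda>i. (xs ! i, last xs) \<in> parcs G"] j(2) n(1)
      unfolding j_def[symmetric] by linarith
    have jn: "Suc j < n" using j(2) n(1) by linarith
    \<comment> \<open>\<open>xs ! j\<close> separates the path into two nonempty sides; since it is
      not a cut vertex, some edge joins the sides.\<close>
    have split: "xs = take j xs @ xs ! j # drop (Suc j) xs"
      using jn n(2) by (simp add: id_take_nth_drop)
    have "pverts G = insert (xs ! j) (set (take j xs) \<union> set (drop (Suc j) xs))"
      using arg_cong[OF split, of set] unfolding xs(2) by simp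
    moreover have "distinct (take j xs @ xs ! j # drop (Suc j) xs)"
      using dist split by simp
    ultimately have "pverts G - {xs ! j} = set (take j xs) \<union> set (drop (Suc j) xs)"
      "set (take j xs) \<inter> set (drop (Suc j) xs) = {}"
      by auto
    moreover have "xs ! j \<in> pverts G" "set (take j xs) \<noteq> {}" "set (drop (Suc j) xs) \<noteq> {}"
      using jn n(2) \<open>j \<noteq> 0\<close> by (auto simp flip: xs(2))
    ultimately obtain v w where vw: "v \<in> set (take j xs)" "w \<in> set (drop (Suc j) xs)" "(v, w) \<in> parcs G"
      using edge_across_cut_vertex[OF assms(1,2)] by metis
    obtain a where a: "a < j" "v = xs ! a"
      using vw(1) by (auto simp: in_set_conv_nth)
    obtain b' where b': "b' < length (drop (Suc j) xs)" "w = drop (Suc j) xs ! b'"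
      using vw(2) by (metis in_set_conv_nth)
    define b where "b = Suc j + b'"
    have b: "j < b" "b < n" "w = xs ! b"
      using b' n(2) by (auto simp: b_def)
    \<comment> \<open>The blocks occupy positions \<open>0\<close> to \<open>a\<close>,
      \<open>a + 1\<close> to \<open>b - 1\<close>, and \<open>b\<close> to \<open>n - 1\<close>. As
      \<open>a < j < b\<close>, the chord from \<open>hd xs\<close> to \<open>a + 1\<close> comes
      from \<open>initial\<close> and the chord from \<open>b - 1\<close> to \<open>last xs\<close>
      from \<open>final\<close>.\<close>
    let ?us = "take (Suc a) xs" and ?vs = "take (b - Suc a) (drop (Suc a) xs)" and ?ws = "drop b xs"
    have "drop (Suc a) xs = ?vs @ ?ws"
      using append_take_drop_id[of "b - Suc a" "drop (Suc a) xs"] a(1) b(1) by simp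
    then have split3: "xs = ?us @ ?vs @ ?ws" by (metis append_take_drop_id)
    have "vertex_cycle (parcs G) (?us @ ?ws @ rev ?vs)"
    proof (rule vertex_cycle_double_crossing[OF sym_parcs])
      show "vertex_path (parcs G) (?us @ ?vs @ ?ws)" using xs(1) split3 by simp
      show "?us \<noteq> []" "?vs \<noteq> []" "?ws \<noteq> []" using a b n by auto
      show "(hd ?us, hd ?vs) \<in> parcs G"
        using initial[OF a(1)] a b n by (simp add: hd_drop_conv_nth)
      show "(last ?us, hd ?ws) \<in> parcs G"
        using vw(3) a b n by (simp add: hd_drop_conv_nth take_Suc_conv_app_nth)
      have lv: "length ?vs = b - Suc a" "?vs \<noteq> []" using a b n by auto
      have "last ?vs = ?vs ! (b - Suc a - 1)"
        unfolding last_conv_nth[OF lv(2)] lv(1) ..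
      also have "\<dots> = xs ! (Suc a + (b - Suc a - 1))"
        using a b n by (subst nth_take) simp_all
      also have "Suc a + (b - Suc a - 1) = b - 1" using a(1) b(1) by linarith
      finally have "last ?vs = xs ! (b - 1)" .
      then show "(last ?vs, last ?ws) \<in> parcs G"
        using final[of "b - 1"] b n by simp
    qed
    moreover have "set (?us @ ?ws @ rev ?vs) = pverts G"
      using arg_cong[OF split3, of set] unfolding xs(2) by auto
    ultimately show ?thesis using noncyc by blast
  qed
qed

section \<open>The closure of a 2-connected graph\<close>

text \<open>
  If a non-adjacent pair had degrees \<open>d \<noteq> e\<close>, then every non-neighbour of a vertex of degree \<open>d\<close> has
  degree \<open>e\<close> and vice versa. As \<open>d + e = n - 1\<close>, there are exactly \<open>d\<close> vertices of degree \<open>d\<close> and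
  \<open>e\<close> of degree \<open>e\<close>, with no edges between the two classes, and the one vertex left over
  is a cut vertex.
\<close>

lemma nonadjacent_degrees_eq:
  assumes "pair_graph G" "k_connected 2 G" "pair_graph H" "pverts H = pverts G" "parcs G \<subseteq> parcs H"
    and sum: "\<And>x y. nonadjacent H x y \<Longrightarrow> degree H x + degree H y + 1 = card (pverts H)"
    and "nonadjacent H x y"
  shows "degree H x = degree H y"
proof (rule ccontr)
  assume neq: "degree H x \<noteq> degree H y"
  interpret H: pair_graph H by fact
  define d where "d = degree H x"
  define e where "e = degree H y"
  define A where "A = {v \<in> pverts H. degree H v = d}"
  define B where "B = {v \<in> pverts H. degree H v = e}"
  have n: "d + e + 1 = card (pverts H)" using sum[OF assms(7)] by (simp add: d_def e_def)
  have fin: "finite A" "finite B" using H.pair_finite_verts by (auto simp: A_def B_def)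
  have disj: "A \<inter> B = {}" using neq by (auto simp: A_def B_def d_def e_def)
  have mem: "x \<in> A" "y \<in> B" using assms(7) by (auto simp: A_def B_def d_def e_def nonadjacent_def)
  have non: "{z. nonadjacent H v z} \<subseteq> {u \<in> pverts H. degree H u = f} \<and> card {z. nonadjacent H v z} = f"
    if v: "v \<in> pverts H" "degree H v + f + 1 = card (pverts H)" for v f
  proof (intro conjI subsetI)
    fix u assume "u \<in> {z. nonadjacent H v z}"
    then show "u \<in> {u \<in> pverts H. degree H u = f}"
      using sum[of v u] v(2) by (auto simp: nonadjacent_def)
  next
    show "card {z. nonadjacent H v z} = f"
      using H.degree_nonadjacent[OF v(1)] v(2) by linarith
  qed
  have nA: "{z. nonadjacent H v z} \<subseteq> B" "card {z. nonadjacent H v z} = e" if "v \<in> A" for v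
    using that n non[of v e] by (simp_all add: A_def B_def)
  have nB: "{z. nonadjacent H v z} \<subseteq> A" "card {z. nonadjacent H v z} = d" if "v \<in> B" for v
    using that n non[of v d] by (simp_all add: A_def B_def add.commute)
  have le: "e \<le> card B" "d \<le> card A"
    using nA[OF mem(1)] nB[OF mem(2)] card_mono[OF fin(2)] card_mono[OF fin(1)] by metis+
  have AB: "A \<union> B \<subseteq> pverts H" by (auto simp: A_def B_def)
  then have total: "card A + card B \<le> d + e + 1"
    using card_mono[OF H.pair_finite_verts AB] card_Un_disjoint[OF fin disj] n by simp
  \<comment> \<open>By \<open>le\<close> and \<open>total\<close>, at most one class exceeds its
    lower bound. If a class attains it, that class is the full set of non-neighbours of every vertex
    in the other.\<close>
  have all: "nonadjacent H a b" if "a \<in> A" "b \<in> B" for a b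
  proof (cases "card B = e")
    case True
    then have "{z. nonadjacent H a z} = B"
      using nA[OF that(1)] card_subset_eq[OF fin(2)] by metis
    then show ?thesis using that(2) by blast
  next
    case False
    then have "card A = d" using total le by linarith
    then have "{z. nonadjacent H b z} = A"
      using nB[OF that(2)] card_subset_eq[OF fin(1)] by metis
    then show ?thesis using that(1) H.nonadjacent_sym by blast
  qed
  then have "{z. nonadjacent H x z} = B" "{z. nonadjacent H y z} = A"
    using nA[OF mem(1)] nB[OF mem(2)] mem H.nonadjacent_sym by blast+
  then have card: "card A = d" "card B = e"
    using nA[OF mem(1)] nB[OF mem(2)] by metis+
  then have "card (pverts H - (A \<union> B)) = 1"
    using card_Diff_subset[OF _ AB] card_Un_disjoint[OF fin disj] fin n by simp
  then obtain w where w: "pverts H - (A \<union> B) = {w}" by (auto simp: card_1_singleton_iff)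
  then have "w \<in> pverts G" "pverts G - {w} = A \<union> B"
    using AB by (auto simp flip: assms(4))
  then obtain a b where "a \<in> A" "b \<in> B" "(a, b) \<in> parcs G"
    using edge_across_cut_vertex[OF assms(1,2), of w A B] mem disj by blast
  then show False
    using all[of a b] assms(5) by (auto simp: nonadjacent_def)
qed

section \<open>Adding an edge to the closure\<close>

lemma hamiltonian_add_edge_regular:
  assumes "pair_graph H" "nonadjacent H x y" "card (pverts H) = 2 * k + 1" "1 \<le> k"
    and deg: "\<And>v. v \<in> pverts H \<Longrightarrow> k \<le> degree H v" and "degree H x = k"
  shows "hamiltonian (add_edge H x y)"
proof (rule hamiltonian_if_Cl_complete)
  let ?F = "add_edge H x y"
  interpret H: pair_graph H by fact
  have F: "pair_graph ?F" using assms(1,2) by (rule pair_graph_add_edge)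
  then show "pair_graph ?F" .
  have verts: "pverts ?F = pverts H" by (simp add: add_edge_def)
  then show "3 \<le> card (pverts ?F)" using assms(3,4) by simp
  define K where "K = Cl (card (pverts ?F)) ?F"
  have K: "pair_graph K" "pverts K = pverts H" "parcs ?F \<subseteq> parcs K"
    using pair_graph_Cl[OF F] pverts_Cl[OF F] parcs_subset_Cl[OF F] by (simp_all add: K_def verts)
  have closed: "degree K u + degree K v < 2 * k + 1" if "nonadjacent K u v" for u v
    using degree_Cl_nonadjacent[OF F] that by (simp add: K_def verts assms(3))
  interpret K: pair_graph K by fact
  have arcs: "parcs H \<subseteq> parcs K" "(x, y) \<in> parcs K"
    using K(3) by (auto simp: add_edge_def)
  have degK: "k \<le> degree K v" if "v \<in> pverts H" for v
    using deg[OF that] degree_mono[OF K(1) arcs(1), of v] by linarith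
  \<comment> \<open>Degrees above \<open>k\<close> and at least \<open>k\<close> sum to
    \<open>2 * k + 1\<close>, the order, which is impossible for a non-adjacent pair of the closed
    graph \<open>K\<close>.\<close>
  have full: "\<not> nonadjacent K u v" if "k < degree K u" for u v
  proof
    assume uv: "nonadjacent K u v"
    then have "k \<le> degree K v" using degK K(2) by (simp add: nonadjacent_def)
    with closed[OF uv] that show False by linarith
  qed
  have x: "x \<in> pverts H" using assms(2) by (simp add: nonadjacent_def)
  have "parcs H `` {x} \<subset> parcs K `` {x}"
    using arcs assms(2) by (auto simp: nonadjacent_def)
  then have "degree H x < degree K x"
    unfolding degree_eq_card_Image using K.finite_neighbours by (rule psubset_card_mono[rotated])
  then have kx: "k < degree K x" using assms(6) by simp
  have kz: "k < degree K z" if "nonadjacent H x z" for z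
  proof -
    have "(x, z) \<in> parcs K"
      using full[OF kx, of z] that K(2) by (auto simp: nonadjacent_def)
    then have "(z, x) \<in> parcs K" by (rule K.arcs_symmetric)
    moreover have "(z, x) \<notin> parcs H" using H.nonadjacent_sym[OF that] by (simp add: nonadjacent_def)
    ultimately have "parcs H `` {z} \<subset> parcs K `` {z}" using arcs(1) by auto
    then have "degree H z < degree K z"
      unfolding degree_eq_card_Image using K.finite_neighbours by (rule psubset_card_mono[rotated])
    moreover have "k \<le> degree H z" using deg that by (simp add: nonadjacent_def)
    ultimately show ?thesis by simp
  qed
  \<comment> \<open>These are \<open>x\<close> and its \<open>k\<close> non-neighbours in
    \<open>H\<close>: \<open>k + 1\<close> vertices, each joined in \<open>K\<close> to all
    others.\<close>
  let ?T = "insert x {z. nonadjacent H x z}"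
  have "card ?T = k + 1"
    using H.degree_nonadjacent[OF x] H.finite_nonadjacent[of x] assms(3,6)
    by (simp add: nonadjacent_def)
  show "\<not> nonadjacent (Cl (card (pverts ?F)) ?F) u v" for u v
    unfolding K_def[symmetric]
  proof
    assume uv: "nonadjacent K u v"
    \<comment> \<open>Having a non-neighbour, \<open>u\<close> lies outside \<open>?T\<close>, so
      all \<open>k + 1\<close> vertices of \<open>?T\<close> are its neighbours and its degree
      exceeds \<open>k\<close>.\<close>
    have "t \<in> parcs K `` {u}" if "t \<in> ?T" for t
    proof -
      have t: "k < degree K t" "t \<in> pverts K"
        using that kx kz x K(2) by (auto simp: nonadjacent_def)
      then have "t \<noteq> u" using full uv by blast
      then have "(t, u) \<in> parcs K"
        using full[OF t(1), of u] t(2) uv by (auto simp: nonadjacent_def)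
      then show ?thesis by (auto dest: K.arcs_symmetric)
    qed
    then have "card ?T \<le> degree K u"
      unfolding degree_eq_card_Image by (intro card_mono K.finite_neighbours) auto
    then show False using full[of u v] uv \<open>card ?T = k + 1\<close> by simp
  qed
qed

theorem theorem1p4:
  fixes G :: "'a pair_pre_digraph" and n :: nat
  assumes "pair_graph G"
    and "card (pverts G) = n" and "n \<ge> 3"
    and "k_connected 2 G"
    and "\<And>x y. nonadjacent G x y \<Longrightarrow> degree G x + degree G y \<ge> n - 1"
  shows "(even n \<longrightarrow> hamiltonian G) \<and>
    (odd n \<longrightarrow> (\<exists>p. graph_cycle G p \<and> length p \<ge> n - 1)) \<and>
    (\<not> hamiltonian G \<longrightarrow>
       real (min_degree (Cl n G)) = (real n - 1) / 2 \<and> maximal_nonhamiltonian (Cl n G))"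
proof -
  define H where "H = Cl n G"
  have H: "pair_graph H" "pverts H = pverts G" "parcs G \<subseteq> parcs H"
    using pair_graph_Cl[OF assms(1)] pverts_Cl[OF assms(1)] parcs_subset_Cl[OF assms(1)]
    by (simp_all add: H_def)
  interpret H: pair_graph H by fact
  \<comment> \<open>Closedness bounds the degree sum strictly below \<open>n\<close>, and the
    hypothesis on \<open>G\<close> gives at least \<open>n - 1\<close>.\<close>
  have sum: "degree H x + degree H y + 1 = card (pverts H)" if "nonadjacent H x y" for x y
    using degree_Cl_nonadjacent[OF assms(1), of n x y]
      Cl_nonadjacent_degree_ge[OF assms(1) _ assms(5), of n x y] that assms(2,3) H(2)
    by (simp add: H_def)
  have half: "2 * degree H x + 1 = n" if "nonadjacent H x y" for x y
    using nonadjacent_degrees_eq[OF assms(1,4) H sum that] sum[OF that] H(2) assms(2) by simp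
  have long: "\<exists>p. graph_cycle G p \<and> length p \<ge> n - 1"
  proof -
    have "card (pverts G) \<le> degree G x + degree G y + 1" if "nonadjacent G x y" for x y
      using assms(5)[OF that] assms(2) by simp
    then obtain xs where xs: "vertex_cycle (parcs G) xs" "card (pverts G) \<le> length xs + 1"
      using ex_long_cycle[OF assms(1,4)] assms(2,3) by blast
    obtain p where "graph_cycle G p" "map fst p = xs"
      using graph_cycle_of_vertex_cycle[OF assms(1) xs(1)] .
    then show ?thesis using xs(2) assms(2) by (intro exI[of _ p]) auto
  qed
  have incomplete: "\<exists>k. n = 2 * k + 1 \<and> min_degree H = k \<and> maximal_nonhamiltonian H"
    if nh: "\<not> hamiltonian G"
  proof -
    have nhH: "\<not> hamiltonian H"
      using nh hamiltonian_Cl[OF assms(1), of n] assms(2) by (auto simp: H_def)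
    then obtain x y where xy: "nonadjacent H x y"
      using H.complete_hamiltonian H(2) assms(2,3) by auto
    define k where "k = degree H x"
    have n: "n = 2 * k + 1" using half[OF xy] by (simp add: k_def)
    \<comment> \<open>A vertex without non-neighbours has degree \<open>n - 1 = 2 * k\<close>; by
      \<open>half\<close>, any other vertex has degree exactly \<open>k\<close>.\<close>
    have deg: "k \<le> degree H v" if "v \<in> pverts H" for v
    proof (cases "{z. nonadjacent H v z} = {}")
      case True
      then show ?thesis
        using H.degree_nonadjacent[OF that] H(2) assms(2) n by simp
    next
      case False
      then show ?thesis using half n by auto
    qed
    have "min_degree H = k"
      unfolding min_degree_def
    proof (rule Min_eqI)
      show "finite (degree H ` pverts H)" using H.pair_finite_verts by simp
      show "k \<in> degree H ` pverts H" using xy by (auto simp: k_def nonadjacent_def)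
    qed (use deg in auto)
    moreover have "hamiltonian (add_edge H u v)" if uv: "nonadjacent H u v" for u v
      using half[OF uv] n H assms(2,3) deg
      by (intro hamiltonian_add_edge_regular[OF H(1) uv, of k]) auto
    ultimately show ?thesis
      using n nhH by (auto simp: maximal_nonhamiltonian_def)
  qed
  \<comment> \<open>A non-hamiltonian \<open>G\<close> would give \<open>n = 2 * k + 1\<close>,
    contradicting parity.\<close>
  then have "hamiltonian G" if "even n"
    using that by (cases "hamiltonian G") fastforce+
  moreover have "real (min_degree H) = (real n - 1) / 2 \<and> maximal_nonhamiltonian H"
    if "\<not> hamiltonian G"
    using incomplete[OF that] by auto
  ultimately show ?thesis
    using long unfolding H_def by blast
qed

end
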